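(* Let $N\in\mathbb N$ and let $g_N$ be the filter function defined in the context. Let $T_n(x)$ denote the Chebyshev polynomial of the first kind of order $n$. Then, for all $\lambda>0$, $$g_N(\lambda)=\frac1\lambda\left[1-\sqrt{\tfrac{\lambda}{4}+1}\,\left(T_{2N+1}\left(\sqrt{\tfrac{\lambda}{4}+1}\right)\right)^{-1}\right].$$
   Context: For fixed $N\in\mathbb N$ define functions $h_N,h_{N-1},\dots,h_1$ of $\lambda$ by the backward recursion $$h_N(\lambda)=\lambda+1,\qquad h_k(\lambda)=2+\lambda-\frac{1}{h_{k+1}(\lambda)},\quad k=N-1,\dots,1,$$ (so the functions $h_k$ depend on $N$), and set $$g_N(\lambda)=\frac1\lambda\left(1-\frac{1}{\prod_{j=1}^N h_j(\lambda)}\right),\qquad\lambda>0 .$$ *)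

theory Defs
  imports Complex_Main "HOL-Computational_Algebra.Polynomial"
begin

(* filter_h N k l is h_k(l) for 1 <= k <= N; the recursion runs backwards from k = N.
   The values at k = 0 and k > N lie outside the index range and are never used. *)
function filter_h :: "nat \<Rightarrow> nat \<Rightarrow> real \<Rightarrow> real" where
  "filter_h N k l = (if k < N then 2 + l - 1 / filter_h N (Suc k) l else l + 1)"
  by pat_completeness auto
termination by (relation "measure (\<lambda>(N, k, l). N - k)") auto

(* The equation of filter_h applies to its own right-hand side, so it must not be a
   default rewrite rule. *)
declare filter_h.simps [simp del]

definition filter_g :: "nat \<Rightarrow> real \<Rightarrow> real" where
  "filter_g N l = 1 / l * (1 - 1 / (\<Prod>j = 1..N. filter_h N j l))"

fun chebyshev_T :: "nat \<Rightarrow> real poly" where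
  "chebyshev_T 0 = 1"
| "chebyshev_T (Suc 0) = [:0, 1:]"
| "chebyshev_T (Suc (Suc n)) = [:0, 2:] * chebyshev_T (Suc n) - chebyshev_T n"

end

(* At x = sqrt (l/4 + 1) the Chebyshev polynomials of odd order satisfy
   T(n+4) = (l + 2) T(n+2) - T(n), because 4 x^2 - 2 = l + 2. Dividing by T(n+2) gives the
   recursion of the h_k, so h_k = T(2(N-k)+3) / T(2(N-k)+1), and the product over k telescopes
   to T(2N+1) / x. No denominator vanishes, because x >= 1 makes T increasing in the order. *)
theory Submission
  imports Defs
begin

text \<open>Since \<open>x \<ge> 1\<close>, the recurrence gives T(n+2) \<ge> 2 T(n+1) - T(n) \<ge>
  T(n+1). The lower bound 1 is carried along because multiplying \<open>x \<ge> 1\<close> by T(n+1)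
  needs a nonnegative factor.\<close>

lemma chebyshev_T_mono_ge_1:
  fixes x :: real
  assumes "x \<ge> 1"
  shows "1 \<le> poly (chebyshev_T n) x \<and> poly (chebyshev_T n) x \<le> poly (chebyshev_T (Suc n)) x"
proof (induction n)
  case 0
  then show ?case using assms by simp
next
  case (Suc n)
  let ?t = "\<lambda>n. poly (chebyshev_T n) x"
  have "1 * ?t (Suc n) \<le> x * ?t (Suc n)"
    using Suc assms by (intro mult_right_mono) auto
  moreover have "?t (Suc (Suc n)) = 2 * (x * ?t (Suc n)) - ?t n"
    by simp
  ultimately show ?case using Suc by linarith
qed

lemma chebyshev_T_pos:
  fixes x :: real
  assumes "x \<ge> 1"
  shows "poly (chebyshev_T n) x > 0"
  using chebyshev_T_mono_ge_1[OF assms, of n] by linarith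

text \<open>The terms of intermediate order are eliminated by 2x T(n+3) = 4x^2 T(n+2) - 2x T(n+1)
  and 2x T(n+1) = T(n+2) + T(n).\<close>

lemma chebyshev_T_step_two:
  "poly (chebyshev_T (n + 4)) x = (4 * x\<^sup>2 - 2) * poly (chebyshev_T (n + 2)) x - poly (chebyshev_T n) x"
proof -
  have n: "n + 4 = Suc (Suc (Suc (Suc n)))" "n + 2 = Suc (Suc n)" by simp_all
  show ?thesis
    unfolding n chebyshev_T.simps by (simp add: power2_eq_square algebra_simps)
qed

lemma filter_h_eq_chebyshev_T:
  fixes l :: real
  assumes "l \<ge> 0" "k \<le> N"
  defines "x \<equiv> sqrt (l / 4 + 1)"
  shows "filter_h N k l = poly (chebyshev_T (2 * (N - k) + 3)) x / poly (chebyshev_T (2 * (N - k) + 1)) x"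
  using \<open>k \<le> N\<close>
proof (induction rule: inc_induct)
  have x: "x \<ge> 1" and l: "4 * x\<^sup>2 = l + 4"
    using \<open>l \<ge> 0\<close> by (simp_all add: x_def)
  {
    case base
    \<comment> \<open>Here T(3)/T(1) = 4x^2 - 3 = l + 1.\<close>
    show ?case
      using x l by (simp add: filter_h.simps numeral_eq_Suc field_simps)
  next
    case (step k)
    define m where "m = 2 * (N - Suc k) + 1"
    have idx: "2 * (N - k) + 3 = m + 4" "2 * (N - k) + 1 = m + 2" "2 * (N - Suc k) + 3 = m + 2"
      using step.hyps by (simp_all add: m_def)
    have "filter_h N k l = 2 + l - poly (chebyshev_T m) x / poly (chebyshev_T (m + 2)) x"
      using step.hyps step.IH[unfolded idx(3), folded m_def] by (simp add: filter_h.simps[of N k])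
    then show ?case
      unfolding idx chebyshev_T_step_two l
      using chebyshev_T_pos[OF x, of "m + 2"]
      \<comment> \<open>T(m+2) has to stay atomic; rewriting m + 2 to successor form would let the
        recurrence unfold it.\<close>
      by (simp add: field_simps del: chebyshev_T.simps add_2_eq_Suc')
  }
qed

text \<open>Downward induction on \<open>k\<close>: the lower limit \<open>Suc k\<close> makes
  \<open>k = N\<close> the empty product, matching T(1)/x = 1, and each new factor T(m+2)/T(m)
  cancels the previous numerator.\<close>

lemma prod_filter_h_eq_chebyshev_T:
  fixes l :: real
  assumes "l \<ge> 0" "k \<le> N"
  defines "x \<equiv> sqrt (l / 4 + 1)"
  shows "(\<Prod>j = Suc k..N. filter_h N j l) = poly (chebyshev_T (2 * (N - k) + 1)) x / x"
  using \<open>k \<le> N\<close>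
proof (induction rule: inc_induct)
  have x: "x \<ge> 1"
    using \<open>l \<ge> 0\<close> by (simp add: x_def)
  {
    case base
    show ?case using x by simp
  next
    case (step k)
    define m where "m = 2 * (N - Suc k) + 1"
    have idx: "2 * (N - k) + 1 = m + 2" "2 * (N - Suc k) + 3 = m + 2"
      using step.hyps by (simp_all add: m_def)
    have "filter_h N (Suc k) l = poly (chebyshev_T (m + 2)) x / poly (chebyshev_T m) x"
      using filter_h_eq_chebyshev_T[OF \<open>l \<ge> 0\<close>, of "Suc k" N] step.hyps
      unfolding idx x_def m_def by simp
    moreover have "(\<Prod>j = Suc k..N. filter_h N j l)
        = filter_h N (Suc k) l * (\<Prod>j = Suc (Suc k)..N. filter_h N j l)"
      using step.hyps by (simp add: prod.atLeast_Suc_atMost)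
    ultimately show ?case
      unfolding idx step.IH[folded m_def]
      using chebyshev_T_pos[OF x, of m] by simp
  }
qed

theorem theorem3p3:
  fixes N :: nat
  assumes "N \<ge> 1"
  shows "\<forall>l::real. l > 0 \<longrightarrow>
    filter_g N l = 1 / l * (1 - sqrt (l / 4 + 1) *
      inverse (poly (chebyshev_T (2 * N + 1)) (sqrt (l / 4 + 1))))"
proof (intro allI impI)
  fix l :: real
  assume "l > 0"
  then show "filter_g N l = 1 / l * (1 - sqrt (l / 4 + 1) *
      inverse (poly (chebyshev_T (2 * N + 1)) (sqrt (l / 4 + 1))))"
    \<comment> \<open>With \<open>k = 0\<close> the tail product is the full product over
      1..N.\<close>
    using prod_filter_h_eq_chebyshev_T[of l 0 N]
    by (simp add: filter_g_def inverse_eq_divide)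
qed

end
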